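(* $\mathrm{ex}_<(n,C_4^{1243})=O(n^{3/2}\log n)$.
   Context: Edge-ordered graph: finite simple graph with a linear order on its edges; isomorphisms preserve order; subgraphs carry induced order; $\mathrm{ex}_<(n,H)$ is the maximum number of edges of an edge-ordered graph on $n$ vertices with no subgraph isomorphic to $H$. $C_4^{1243}$ is the 4-cycle $abcd$ whose edges $ab,bc,cd,da$ receive labels $1,2,4,3$ respectively, ordered by label (i.e. $ab<bc<da<cd$). *)

theory Defs
  imports Complex_Main "HOL-Library.Landau_Symbols"
begin

record 'a eo_graph =
  verts :: "'a set"
  edges :: "'a set set"
  eord :: "'a set rel"

definition edge_ordered_graph :: "'a eo_graph \<Rightarrow> bool" where
  "edge_ordered_graph G \<longleftrightarrow>
     finite (verts G) \<and>
     edges G \<subseteq> {e. e \<subseteq> verts G \<and> card e = 2} \<and>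
     linear_order_on (edges G) (eord G)"

definition eo_subgraph :: "'a eo_graph \<Rightarrow> 'a eo_graph \<Rightarrow> bool" where
  "eo_subgraph S G \<longleftrightarrow>
     edge_ordered_graph S \<and> edge_ordered_graph G \<and>
     verts S \<subseteq> verts G \<and> edges S \<subseteq> edges G \<and>
     eord S = eord G \<inter> (edges S \<times> edges S)"

definition eo_isomorphic :: "'a eo_graph \<Rightarrow> 'b eo_graph \<Rightarrow> bool" where
  "eo_isomorphic G H \<longleftrightarrow>
     (\<exists>f. bij_betw f (verts G) (verts H) \<and>
          (\<forall>u\<in>verts G. \<forall>v\<in>verts G. {u, v} \<in> edges G \<longleftrightarrow> {f u, f v} \<in> edges H) \<and>
          (\<forall>e\<in>edges G. \<forall>e'\<in>edges G. (e, e') \<in> eord G \<longleftrightarrow> (f ` e, f ` e') \<in> eord H))"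

definition eo_contains :: "'a eo_graph \<Rightarrow> 'b eo_graph \<Rightarrow> bool" where
  "eo_contains G H \<longleftrightarrow> (\<exists>S. eo_subgraph S G \<and> eo_isomorphic S H)"

text \<open>
  Every finite edge-ordered graph is isomorphic to one whose vertices are natural numbers, so
  host graphs are taken over \<^typ>\<open>nat\<close>. The maximum is over a finite set, which is nonempty
  whenever \<open>H\<close> has an edge (lemmas \<open>ex_sizes_finite\<close>, \<open>ex_sizes_nonempty\<close>).
\<close>

definition ex_sizes :: "nat \<Rightarrow> 'b eo_graph \<Rightarrow> nat set" where
  "ex_sizes n H =
     {card (edges G) | G :: nat eo_graph.
        edge_ordered_graph G \<and> card (verts G) = n \<and> \<not> eo_contains G H}"

definition ex_less :: "nat \<Rightarrow> 'b eo_graph \<Rightarrow> nat" where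
  "ex_less n H = Max (ex_sizes n H)"

definition labelled_graph :: "'a set \<Rightarrow> 'a set set \<Rightarrow> ('a set \<Rightarrow> nat) \<Rightarrow> 'a eo_graph" where
  "labelled_graph V E l =
     \<lparr>verts = V, edges = E, eord = {(e, e'). e \<in> E \<and> e' \<in> E \<and> l e \<le> l e'}\<rparr>"

text \<open>The vertices \<open>a, b, c, d\<close> are \<open>0, 1, 2, 3\<close>.\<close>

definition C4_1243 :: "nat eo_graph" where
  "C4_1243 =
     labelled_graph {0, 1, 2, 3} {{0, 1}, {1, 2}, {2, 3}, {3, 0}}
       ((\<lambda>_. 0)({0, 1} := 1, {1, 2} := 2, {2, 3} := 4, {3, 0} := 3))"

lemma ex_sizes_finite: "finite (ex_sizes n H)"
proof (rule finite_subset)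
  show "ex_sizes n H \<subseteq> {..2 ^ n}"
  proof
    fix m assume "m \<in> ex_sizes n H"
    then obtain G :: "nat eo_graph" where G: "m = card (edges G)" "edge_ordered_graph G"
      "card (verts G) = n" by (auto simp: ex_sizes_def)
    then have "finite (verts G)" "edges G \<subseteq> Pow (verts G)"
      by (auto simp: edge_ordered_graph_def)
    then have "card (edges G) \<le> card (Pow (verts G))" by (intro card_mono) auto
    then show "m \<in> {..2 ^ n}" using G \<open>finite (verts G)\<close> by (simp add: card_Pow)
  qed
qed simp

lemma ex_sizes_nonempty:
  assumes "edge_ordered_graph H" "edges H \<noteq> {}"
  shows "ex_sizes n H \<noteq> {}"
proof -
  define G :: "nat eo_graph" where "G = \<lparr>verts = {..<n}, edges = {}, eord = {}\<rparr>"
  have G: "edge_ordered_graph G" "card (verts G) = n"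
    by (auto simp: G_def edge_ordered_graph_def)
  obtain e where e: "e \<in> edges H" using assms by auto
  with assms(1) have "e \<subseteq> verts H" "card e = 2"
    by (auto simp: edge_ordered_graph_def)
  then obtain x y where xy: "e = {x, y}" "x \<in> verts H" "y \<in> verts H"
    by (auto simp: card_2_iff)
  have "\<not> eo_contains G H"
  proof
    assume "eo_contains G H"
    then obtain S :: "nat eo_graph" where S: "edges S = {}" and "eo_isomorphic S H"
      by (auto simp: eo_contains_def eo_subgraph_def G_def)
    then obtain f where f: "bij_betw f (verts S) (verts H)"
      "\<And>u v. u \<in> verts S \<Longrightarrow> v \<in> verts S \<Longrightarrow> {f u, f v} \<notin> edges H"
      by (auto simp: eo_isomorphic_def)
    from f(1) xy obtain u v where "u \<in> verts S" "v \<in> verts S" "f u = x" "f v = y"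
      by (metis bij_betw_imp_surj_on imageE)
    with f(2) e xy show False by blast
  qed
  with G show ?thesis by (auto simp: ex_sizes_def)
qed

lemma labelled_graph_edge_ordered:
  assumes "finite V" "\<And>e. e \<in> E \<Longrightarrow> e \<subseteq> V \<and> card e = 2" "inj_on l E"
  shows "edge_ordered_graph (labelled_graph V E l)"
proof -
  have "linear_order_on E {(e, e'). e \<in> E \<and> e' \<in> E \<and> l e \<le> l e'}"
    unfolding linear_order_on_def partial_order_on_def preorder_on_def
  proof (intro conjI)
    show "antisym {(e, e'). e \<in> E \<and> e' \<in> E \<and> l e \<le> l e'}"
      using assms(3) by (intro antisymI) (auto dest: inj_onD)
  qed (auto simp: refl_on_def trans_def total_on_def)
  with assms show ?thesis
    by (auto simp: edge_ordered_graph_def labelled_graph_def)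
qed

lemma C4_1243_edge_ordered: "edge_ordered_graph C4_1243"
  unfolding C4_1243_def
proof (rule labelled_graph_edge_ordered)
  show "e \<subseteq> {0, 1, 2, 3} \<and> card e = 2"
    if "e \<in> {{0, 1}, {1, 2}, {2, 3}, {3, 0}}" for e :: "nat set"
    using that by (elim insertE emptyE) simp_all
  show "inj_on ((\<lambda>_. 0 :: nat)({0, 1} := 1, {1, 2} := 2, {2, 3} := 4, {3, 0} := 3))
          {{0, 1}, {1, 2}, {2, 3}, {3, 0 :: nat}}"
    by (simp add: doubleton_eq_iff)
qed simp

end

theory Submission
  imports Defs "HOL-Analysis.Convex"
begin

text \<open>
  The argument is that of Marcus and Tardos for intersection reverse sequences. Over an ordered
  pair \<open>(a, c)\<close>, the cherries \<open>a b c\<close> with \<open>ab < bc\<close> form a chain of nested intervals in the edge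
  order, so \<open>a\<close> and \<open>c\<close> see their centres \<open>b\<close> in opposite orders. Cut the edge order into blocks of
  length \<open>2 ^ k\<close>, let \<open>D(b, b')\<close> be the number of \<open>a\<close> with \<open>ab < ab'\<close> in a common block minus the number
  with \<open>ab > ab'\<close> in a common block, and expand \<open>0 \<le> \<Sum> D(b, b')\<^sup>2\<close> as a sum over pairs \<open>(a, c)\<close>. The
  centres of cherries that are cut by the blocks of length \<open>2 ^ k\<close> but not by those of length
  \<open>2 ^ (k + 1)\<close> lie, for fixed \<open>(a, c)\<close>, in a single pair of blocks and contribute negatively; with \<open>r\<close>
  denoting their number, \<open>\<Sum> r\<^sup>2\<close> is at most twice the sum of the squared degrees. Every cherry is cut
  at one of \<open>O(log n)\<close> levels, and Cauchy--Schwarz at each level bounds the number of cherries by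
  \<open>O(n\<^sup>2 log\<^sup>2 n)\<close>.
\<close>

text \<open>The double sum decouples over the fibres of \<open>g\<close>, and on each fibre it is a
  perfect square. Hence all fibres but one can later be discarded from a lower bound.\<close>

lemma sum_same_fibre:
  fixes h :: "'b \<Rightarrow> real"
  assumes "finite C"
  shows "(\<Sum>b\<in>C. \<Sum>b'\<in>C. if g b = g b' then h b * h b' else 0) =
    (\<Sum>x\<in>g ` C. (\<Sum>b | b \<in> C \<and> g b = x. h b)\<^sup>2)"
proof -
  have "(\<Sum>b\<in>C. \<Sum>b'\<in>C. if g b = g b' then h b * h b' else 0) =
      (\<Sum>b\<in>C. h b * (\<Sum>b' | b' \<in> C \<and> g b' = g b. h b'))"
    using assms by (intro sum.cong refl)
      (simp add: sum_distrib_left sum.inter_filter[symmetric] if_distrib eq_commute cong: if_cong)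
  also have "\<dots> = (\<Sum>x\<in>g ` C. \<Sum>b | b \<in> C \<and> g b = x. h b * (\<Sum>b' | b' \<in> C \<and> g b' = g b. h b'))"
    using assms by (subst sum.image_gen[where g = g]) auto
  also have "\<dots> = (\<Sum>x\<in>g ` C. (\<Sum>b | b \<in> C \<and> g b = x. h b)\<^sup>2)"
    by (intro sum.cong refl) (simp add: power2_eq_square sum_distrib_right)
  finally show ?thesis .
qed

section \<open>Graphs with numerical edge ranks: cherries, levels and block signs\<close>

locale ranked_graph =
  fixes V :: "'a set" and adj :: "'a \<Rightarrow> 'a \<Rightarrow> bool" and rk :: "'a \<Rightarrow> 'a \<Rightarrow> nat"
  assumes finite_V: "finite V"
    and adj_V: "adj a b \<Longrightarrow> a \<in> V"
    and adj_sym: "adj a b \<Longrightarrow> adj b a"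
    and adj_irrefl: "\<not> adj a a"
    and rk_sym: "rk a b = rk b a"
    and rk_inj: "adj a b \<Longrightarrow> adj c d \<Longrightarrow> rk a b = rk c d \<Longrightarrow> {a, b} = {c, d}"
    and C4_free: "distinct [a, b, c, d] \<Longrightarrow> adj a b \<Longrightarrow> adj b c \<Longrightarrow> adj c d \<Longrightarrow> adj d a \<Longrightarrow>
      \<not> (rk a b < rk b c \<and> rk b c < rk d a \<and> rk d a < rk c d)"
begin

definition nbh :: "'a \<Rightarrow> 'a set" where
  "nbh a = {b. adj a b}"

definition square_degree_sum :: nat where
  "square_degree_sum = (\<Sum>a\<in>V. card (nbh a) ^ 2)"

text \<open>Dividing by \<open>2 ^ k\<close> gives the index of the dyadic block containing a rank.
  Only cherries increasing from \<open>a\<close> to \<open>c\<close> are collected; the decreasing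
  ones appear with \<open>a\<close> and \<open>c\<close> exchanged.\<close>

definition split_cherries :: "nat \<Rightarrow> 'a \<Rightarrow> 'a \<Rightarrow> 'a set" where
  "split_cherries k a c = {b \<in> nbh a \<inter> nbh c. rk a b < rk c b \<and>
     rk a b div 2 ^ k \<noteq> rk c b div 2 ^ k \<and> rk a b div 2 ^ Suc k = rk c b div 2 ^ Suc k}"

text \<open>Summed over \<open>a\<close>, this is the quantity \<open>D(b, b')\<close> of the
  outline.\<close>

definition block_sign :: "nat \<Rightarrow> 'a \<Rightarrow> 'a \<Rightarrow> 'a \<Rightarrow> real" where
  "block_sign k a b b' =
     (if b \<in> nbh a \<and> b' \<in> nbh a \<and> b \<noteq> b' \<and> rk a b div 2 ^ k = rk a b' div 2 ^ k
      then if rk a b < rk a b' then 1 else - 1 else 0)"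

section \<open>Nesting of cherries and its consequences\<close>

lemma nbh_subset: "nbh a \<subseteq> V"
  unfolding nbh_def using adj_V adj_sym by blast

lemma finite_nbh [simp]: "finite (nbh a)"
  using finite_subset[OF nbh_subset finite_V] .

lemma nbh_sym: "b \<in> nbh a \<longleftrightarrow> a \<in> nbh b"
  unfolding nbh_def using adj_sym by blast

lemma rk_neq:
  assumes "b \<in> nbh a" "d \<in> nbh c" "{a, b} \<noteq> {c, d}"
  shows "rk a b \<noteq> rk c d"
  using assms rk_inj[of a b c d] by (auto simp: nbh_def)

text \<open>Two cherries over \<open>(a, c)\<close> increasing in the same direction are neither disjoint nor
  crossing as intervals of ranks, since both configurations are copies of the forbidden cycle.\<close>

lemma cherries_nested:
  assumes "a \<noteq> c" "b \<noteq> b'" "b \<in> nbh a \<inter> nbh c" "b' \<in> nbh a \<inter> nbh c"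
    and "rk a b < rk c b" "rk a b' < rk c b'" "rk a b < rk a b'"
  shows "rk a b' < rk c b" "rk c b' < rk c b"
proof -
  have adj: "adj a b" "adj b a" "adj c b" "adj b c" "adj a b'" "adj b' a" "adj c b'" "adj b' c"
    using assms by (auto simp: nbh_def intro: adj_sym)
  then have ne: "a \<noteq> b" "a \<noteq> b'" "c \<noteq> b" "c \<noteq> b'"
    using adj_irrefl by auto
  have "rk a b' \<noteq> rk c b" "rk c b' \<noteq> rk c b"
    using rk_inj[of a b' c b] rk_inj[of c b' c b] adj assms ne by (auto simp: doubleton_eq_iff)
  moreover have "\<not> rk c b < rk a b'"
    using C4_free[of a b c b'] adj ne assms by (auto simp: rk_sym)
  ultimately show *: "rk a b' < rk c b"
    by linarith
  have "\<not> rk c b < rk c b'"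
    using C4_free[of b a b' c] adj ne assms * by (auto simp: rk_sym)
  with \<open>rk c b' \<noteq> rk c b\<close> show "rk c b' < rk c b"
    by linarith
qed

text \<open>Of two nested intervals, the one that starts later ends earlier. Decreasing cherries
  reduce to increasing ones over \<open>(c, a)\<close>.\<close>

lemma reversed_order:
  assumes "a \<noteq> c" "b \<noteq> b'" "b \<in> nbh a \<inter> nbh c" "b' \<in> nbh a \<inter> nbh c"
    and "rk a b < rk c b \<longleftrightarrow> rk a b' < rk c b'"
  shows "rk a b < rk a b' \<longleftrightarrow> \<not> rk c b < rk c b'"
proof -
  have ne: "rk a b \<noteq> rk a b'" "rk c b \<noteq> rk c b'" "rk a b \<noteq> rk c b" "rk a b' \<noteq> rk c b'"
    using rk_neq[of b a b' a] rk_neq[of b c b' c] rk_neq[of b a b c] rk_neq[of b' a b' c] assms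
    by (auto simp: doubleton_eq_iff)
  show ?thesis
  proof (cases "rk a b < rk c b")
    case True
    then show ?thesis
      using cherries_nested(2)[of a c b b'] cherries_nested(2)[of a c b' b] assms ne
      by (metis nat_neq_iff not_less_iff_gr_or_eq)
  next
    case False
    then have "rk c b < rk a b" "rk c b' < rk a b'"
      using assms ne by auto
    then show ?thesis
      using cherries_nested(2)[of c a b b'] cherries_nested(2)[of c a b' b] assms ne
      by (metis Int_commute nat_neq_iff not_less_iff_gr_or_eq)
  qed
qed

text \<open>Nesting forces all these cherries into one block of length \<open>2 ^ Suc k\<close>;
  being split at its midpoint, each has its lower rank in the left half and its upper rank in the
  right half.\<close>

lemma split_cherries_block:
  assumes "a \<noteq> c" "b \<in> split_cherries k a c" "b' \<in> split_cherries k a c"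
  shows "rk a b div 2 ^ k = rk a b' div 2 ^ k \<and> rk c b div 2 ^ k = rk c b' div 2 ^ k"
proof -
  \<comment> \<open>Block \<open>j\<close> of level \<open>Suc k\<close> consists of the blocks
    \<open>2 * j\<close> and \<open>2 * j + 1\<close> of level \<open>k\<close>.\<close>
  have half: "x div 2 ^ k = 2 * (x div 2 ^ Suc k) \<and> y div 2 ^ k = 2 * (x div 2 ^ Suc k) + 1"
    if "x < y" "x div 2 ^ k \<noteq> y div 2 ^ k" "x div 2 ^ Suc k = y div 2 ^ Suc k" for x y :: nat
  proof -
    have "x div 2 ^ k < y div 2 ^ k"
      using that by (simp add: div_le_mono order_less_le)
    moreover have "z div 2 ^ Suc k = (z div 2 ^ k) div 2" for z :: nat
      by (simp only: power_Suc2 div_mult2_eq)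
    moreover have "u = 2 * (u div 2) \<and> v = 2 * (u div 2) + 1"
      if "u < v" "u div 2 = v div 2" for u v :: nat
      using that by presburger
    ultimately show ?thesis
      using that(3) by metis
  qed
  \<comment> \<open>The later start \<open>rk a v\<close> lies between \<open>rk a u\<close> and
    \<open>rk c u\<close>, which share a block of level \<open>Suc k\<close>.\<close>
  have parent: "rk a u div 2 ^ Suc k = rk a v div 2 ^ Suc k"
    if uv: "u \<in> split_cherries k a c" "v \<in> split_cherries k a c" "rk a u < rk a v" for u v
  proof -
    have "rk a v < rk c u"
      using uv assms by (intro cherries_nested(1)[of a c u v]) (auto simp: split_cherries_def)
    then have "rk a u div 2 ^ Suc k \<le> rk a v div 2 ^ Suc k"
        "rk a v div 2 ^ Suc k \<le> rk c u div 2 ^ Suc k"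
      using uv by (auto intro!: div_le_mono simp del: power_Suc)
    then show ?thesis
      using uv by (simp add: split_cherries_def del: power_Suc)
  qed
  have "rk a b div 2 ^ Suc k = rk a b' div 2 ^ Suc k"
    using parent[of b b'] parent[of b' b] assms
    by (metis linorder_neqE_nat)
  moreover have "rk a u div 2 ^ k = 2 * (rk a u div 2 ^ Suc k) \<and>
      rk c u div 2 ^ k = 2 * (rk a u div 2 ^ Suc k) + 1" if "u \<in> split_cherries k a c" for u
    using that by (intro half) (auto simp: split_cherries_def simp del: power_Suc)
  ultimately show ?thesis
    using assms by metis
qed

section \<open>The quadratic form in the block signs\<close>

lemma sum_block_sign_mult_le:
  assumes "a \<noteq> c"
  shows "(\<Sum>b\<in>V. \<Sum>b'\<in>V. block_sign k a b b' * block_sign k c b b') \<le>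
    real (card (nbh a \<inter> nbh c)) - real (card (split_cherries k a c)) ^ 2"
proof -
  define C where "C = nbh a \<inter> nbh c"
  define g where "g b = (rk a b div 2 ^ k, rk c b div 2 ^ k)" for b
  define h :: "'a \<Rightarrow> real" where "h b = (if rk a b < rk c b then 1 else - 1)" for b
  have C: "finite C" "C \<subseteq> V"
    using nbh_subset by (auto simp: C_def)
  have "(\<Sum>b\<in>V. \<Sum>b'\<in>V. block_sign k a b b' * block_sign k c b b') =
      (\<Sum>b\<in>C. \<Sum>b'\<in>C. block_sign k a b b' * block_sign k c b b')"
  proof -
    have "(\<Sum>b'\<in>V. block_sign k a b b' * block_sign k c b b') =
        (\<Sum>b'\<in>C. block_sign k a b b' * block_sign k c b b')" for b
      using C finite_V by (intro sum.mono_neutral_right) (auto simp: block_sign_def C_def)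
    moreover have "(\<Sum>b\<in>V. \<Sum>b'\<in>C. block_sign k a b b' * block_sign k c b b') =
        (\<Sum>b\<in>C. \<Sum>b'\<in>C. block_sign k a b b' * block_sign k c b b')"
      using C finite_V
      by (intro sum.mono_neutral_right ballI sum.neutral) (auto simp: block_sign_def C_def)
    ultimately show ?thesis by simp
  qed
  \<comment> \<open>For distinct \<open>b\<close>, \<open>b'\<close> with equal \<open>g\<close>,
    equal directions give product \<open>-1\<close> by \<open>reversed_order\<close>, and opposite
    directions are bounded trivially by \<open>1\<close>; both bounds are
    \<open>- h b * h b'\<close>. For \<open>b = b'\<close> both sides vanish.\<close>
  also have "\<dots> \<le> (\<Sum>b\<in>C. \<Sum>b'\<in>C. (if b = b' then 1 else 0) - (if g b = g b' then h b * h b' else 0))"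
  proof (intro sum_mono)
    fix b b' assume b: "b \<in> C" "b' \<in> C"
    show "block_sign k a b b' * block_sign k c b b' \<le>
        (if b = b' then 1 else 0) - (if g b = g b' then h b * h b' else 0)"
      using reversed_order[OF assms, of b b'] b
      by (auto simp: block_sign_def C_def g_def h_def)
  qed
  also have "\<dots> = real (card C) - (\<Sum>b\<in>C. \<Sum>b'\<in>C. if g b = g b' then h b * h b' else 0)"
    using C by (simp add: sum_subtractf)
  also have "(\<Sum>b\<in>C. \<Sum>b'\<in>C. if g b = g b' then h b * h b' else 0) =
      (\<Sum>x\<in>g ` C. (\<Sum>b | b \<in> C \<and> g b = x. h b)\<^sup>2)"
    by (rule sum_same_fibre[OF C(1)])
  also have "real (card C) - \<dots> \<le> real (card C) - real (card (split_cherries k a c)) ^ 2"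
  proof (cases "split_cherries k a c = {}")
    case True
    then show ?thesis by (simp add: sum_nonneg)
  next
    case False
    then obtain b0 where b0: "b0 \<in> split_cherries k a c" by blast
    then have b0': "b0 \<in> C" "rk a b0 div 2 ^ k < rk c b0 div 2 ^ k"
      by (auto simp: split_cherries_def C_def order_less_le div_le_mono)
    let ?F = "{b \<in> C. g b = g b0}"
    \<comment> \<open>All of this fibre has its \<open>a\<close>-block strictly before its
      \<open>c\<close>-block, so every cherry in it is increasing and no cancellation
      occurs.\<close>
    have "h b = 1" if "b \<in> ?F" for b
      using that b0' div_le_mono[of "rk c b" "rk a b" "2 ^ k"]
      by (force simp: h_def g_def not_less)
    then have "(\<Sum>b\<in>?F. h b) = card ?F"
      by simp
    moreover have "split_cherries k a c \<subseteq> ?F"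
      using split_cherries_block[OF assms b0]
      by (auto simp: split_cherries_def C_def g_def simp del: power_Suc)
    then have "card (split_cherries k a c) \<le> card ?F"
      using C by (intro card_mono) auto
    ultimately have "real (card (split_cherries k a c)) ^ 2 \<le> (\<Sum>b\<in>?F. h b)\<^sup>2"
      by (simp add: power_mono)
    also have "\<dots> \<le> (\<Sum>x\<in>g ` C. (\<Sum>b | b \<in> C \<and> g b = x. h b)\<^sup>2)"
      using C b0' by (intro member_le_sum[of "g b0"]) auto
    finally show ?thesis by simp
  qed
  finally show ?thesis by (simp add: C_def)
qed

text \<open>This covers the diagonal \<open>a = c\<close>, where order reversal says nothing; each
  sign has absolute value at most \<open>1\<close>.\<close>

lemma sum_block_sign_sq_le:
  "(\<Sum>b\<in>V. \<Sum>b'\<in>V. block_sign k a b b' * block_sign k a b b') \<le> real (card (nbh a) ^ 2)"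
proof -
  have "(\<Sum>b\<in>V. \<Sum>b'\<in>V. block_sign k a b b' * block_sign k a b b') \<le>
      (\<Sum>b\<in>V. \<Sum>b'\<in>V. of_bool (b \<in> nbh a) * of_bool (b' \<in> nbh a))"
    by (intro sum_mono) (auto simp: block_sign_def)
  also have "\<dots> = (\<Sum>b\<in>V. of_bool (b \<in> nbh a))\<^sup>2"
    by (simp only: sum_product power2_eq_square)
  also have "(\<Sum>b\<in>V. of_bool (b \<in> nbh a)) = real (card (nbh a))"
    using finite_V nbh_subset by (simp add: sum_of_bool_eq Int_absorb1)
  finally show ?thesis by simp
qed

text \<open>Double counting by the centre \<open>b\<close>, which is joined to
  \<open>card (nbh b) ^ 2\<close> ordered pairs \<open>(a, c)\<close>, those with
  \<open>a = c\<close> included.\<close>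

lemma sum_card_common_nbh: "(\<Sum>a\<in>V. \<Sum>c\<in>V. card (nbh a \<inter> nbh c)) = square_degree_sum"
proof -
  have card: "card (nbh b) = (\<Sum>a\<in>V. of_bool (b \<in> nbh a))" for b
  proof -
    have "V \<inter> {a. b \<in> nbh a} = nbh b"
      using nbh_subset nbh_sym by blast
    then show ?thesis
      using finite_V by (simp only: sum_of_bool_eq of_nat_id)
  qed
  have "card (nbh a \<inter> nbh c) = (\<Sum>b\<in>V. of_bool (b \<in> nbh a) * of_bool (b \<in> nbh c))" for a c
  proof -
    have "V \<inter> {b. b \<in> nbh a \<and> b \<in> nbh c} = nbh a \<inter> nbh c"
      using nbh_subset by blast
    then show ?thesis
      using finite_V by (simp only: of_bool_conj[symmetric] sum_of_bool_eq of_nat_id)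
  qed
  then have "(\<Sum>a\<in>V. \<Sum>c\<in>V. card (nbh a \<inter> nbh c)) =
      (\<Sum>a\<in>V. \<Sum>c\<in>V. \<Sum>b\<in>V. of_bool (b \<in> nbh a) * of_bool (b \<in> nbh c))"
    by simp
  also have "\<dots> = (\<Sum>a\<in>V. \<Sum>b\<in>V. \<Sum>c\<in>V. of_bool (b \<in> nbh a) * of_bool (b \<in> nbh c))"
    by (intro sum.cong refl sum.swap)
  also have "\<dots> = (\<Sum>b\<in>V. \<Sum>a\<in>V. \<Sum>c\<in>V. of_bool (b \<in> nbh a) * of_bool (b \<in> nbh c))"
    by (rule sum.swap)
  also have "\<dots> = square_degree_sum"
    unfolding square_degree_sum_def card power2_eq_square sum_product ..
  finally show ?thesis .
qed

lemma sum_split_cherries_sq_le: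
  "(\<Sum>a\<in>V. \<Sum>c\<in>V. real (card (split_cherries k a c)) ^ 2) \<le> 2 * square_degree_sum"
proof -
  let ?S = "block_sign k"
  let ?D = "\<lambda>a c. if a = c then real (card (nbh a) ^ 2) else 0"
  have "0 \<le> (\<Sum>b\<in>V. \<Sum>b'\<in>V. (\<Sum>a\<in>V. ?S a b b')\<^sup>2)"
    by (intro sum_nonneg) auto
  also have "\<dots> = (\<Sum>p\<in>V \<times> V. (\<Sum>a\<in>V. ?S a (fst p) (snd p))\<^sup>2)"
    by (simp add: sum.cartesian_product case_prod_unfold)
  also have "\<dots> = (\<Sum>p\<in>V \<times> V. \<Sum>q\<in>V \<times> V. ?S (fst q) (fst p) (snd p) * ?S (snd q) (fst p) (snd p))"
    by (intro sum.cong refl)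
      (simp add: power2_eq_square sum_product sum.cartesian_product case_prod_unfold)
  also have "\<dots> = (\<Sum>q\<in>V \<times> V. \<Sum>p\<in>V \<times> V. ?S (fst q) (fst p) (snd p) * ?S (snd q) (fst p) (snd p))"
    by (rule sum.swap)
  also have "\<dots> = (\<Sum>q\<in>V \<times> V. \<Sum>b\<in>V. \<Sum>b'\<in>V. ?S (fst q) b b' * ?S (snd q) b b')"
    by (intro sum.cong refl) (simp add: sum.cartesian_product case_prod_unfold)
  also have "\<dots> = (\<Sum>a\<in>V. \<Sum>c\<in>V. \<Sum>b\<in>V. \<Sum>b'\<in>V. ?S a b b' * ?S c b b')"
    by (subst (2) sum.cartesian_product) (simp only: case_prod_unfold)
  \<comment> \<open>The diagonal bound \<open>?D\<close> and the common neighbourhoods each sum to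
    \<open>square_degree_sum\<close>, whence the factor 2. The latter term is kept on the diagonal
    too, so that \<open>sum_card_common_nbh\<close> applies.\<close>
  also have "\<dots> \<le> (\<Sum>a\<in>V. \<Sum>c\<in>V. ?D a c + real (card (nbh a \<inter> nbh c))
      - real (card (split_cherries k a c)) ^ 2)"
  proof (intro sum_mono)
    fix a c
    show "(\<Sum>b\<in>V. \<Sum>b'\<in>V. ?S a b b' * ?S c b b') \<le>
        ?D a c + real (card (nbh a \<inter> nbh c)) - real (card (split_cherries k a c)) ^ 2"
    proof (cases "a = c")
      case True
      then have "split_cherries k a c = {}" by (auto simp: split_cherries_def)
      with True sum_block_sign_sq_le[of k a] show ?thesis by simp
    next
      case False
      with sum_block_sign_mult_le[of a c k] show ?thesis by simp
    qed
  qed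
  also have "\<dots> = 2 * square_degree_sum - (\<Sum>a\<in>V. \<Sum>c\<in>V. real (card (split_cherries k a c)) ^ 2)"
  proof -
    have "(\<Sum>a\<in>V. \<Sum>c\<in>V. ?D a c) = square_degree_sum"
      using finite_V by (simp add: square_degree_sum_def)
    moreover have "(\<Sum>a\<in>V. \<Sum>c\<in>V. real (card (nbh a \<inter> nbh c))) = square_degree_sum"
      by (simp flip: sum_card_common_nbh)
    ultimately show ?thesis
      by (simp add: sum_subtractf sum.distrib)
  qed
  finally show ?thesis by simp
qed


section \<open>Summation over the levels\<close>

lemma increasing_cherries_split:
  assumes "\<And>a b. adj a b \<Longrightarrow> rk a b < 2 ^ H"
  shows "{b \<in> nbh a \<inter> nbh c. rk a b < rk c b} \<subseteq> (\<Union>k<H. split_cherries k a c)"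
proof
  fix b assume b: "b \<in> {b \<in> nbh a \<inter> nbh c. rk a b < rk c b}"
  let ?P = "\<lambda>k. rk a b div 2 ^ k = rk c b div 2 ^ k"
  \<comment> \<open>At level \<open>H\<close> all ranks share block 0, while at level 0 blocks are
    single ranks; the cherry is split at the level just before its two ranks first merge.\<close>
  have "?P H"
    using assms[of a b] assms[of c b] b by (auto simp: nbh_def)
  moreover have "\<not> ?P 0"
    using b by auto
  ultimately obtain k where "k < H" "\<not> ?P k" "?P (Suc k)"
    using ex_least_nat_less[of ?P H] by blast
  then show "b \<in> (\<Union>k<H. split_cherries k a c)"
    using b by (auto simp: split_cherries_def simp del: power_Suc)
qed

lemma card_common_nbh_le:
  assumes "\<And>a b. adj a b \<Longrightarrow> rk a b < 2 ^ H" "a \<noteq> c"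
  shows "card (nbh a \<inter> nbh c) \<le>
    (\<Sum>k<H. card (split_cherries k a c) + card (split_cherries k c a))"
proof -
  have fin: "finite (split_cherries k x y)" for k x y
    by (rule finite_subset[of _ "nbh x"]) (auto simp: split_cherries_def)
  have "nbh a \<inter> nbh c \<subseteq> (\<Union>k<H. split_cherries k a c \<union> split_cherries k c a)"
  proof
    fix b assume b: "b \<in> nbh a \<inter> nbh c"
    then have "rk a b \<noteq> rk c b"
      using assms(2) by (intro rk_neq) (auto simp: doubleton_eq_iff)
    then consider "rk a b < rk c b" | "rk c b < rk a b"
      by linarith
    then show "b \<in> (\<Union>k<H. split_cherries k a c \<union> split_cherries k c a)"
      using increasing_cherries_split[OF assms(1), of a c]
        increasing_cherries_split[OF assms(1), of c a] b by cases blast+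
  qed
  then have "card (nbh a \<inter> nbh c) \<le> card (\<Union>k<H. split_cherries k a c \<union> split_cherries k c a)"
    by (intro card_mono) (auto simp: fin)
  also have "\<dots> \<le> (\<Sum>k<H. card (split_cherries k a c \<union> split_cherries k c a))"
    by (rule card_UN_le) simp
  also have "\<dots> \<le> (\<Sum>k<H. card (split_cherries k a c) + card (split_cherries k c a))"
    by (intro sum_mono card_Un_le)
  finally show ?thesis .
qed

text \<open>Cauchy-Schwarz over the \<open>card V ^ 2\<close> ordered pairs.\<close>

lemma sum_split_cherries_le:
  "(\<Sum>a\<in>V. \<Sum>c\<in>V. real (card (split_cherries k a c))) \<le>
    real (card V) * sqrt (2 * square_degree_sum)"
proof -
  have "(\<Sum>a\<in>V. \<Sum>c\<in>V. real (card (split_cherries k a c)))\<^sup>2 \<le>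
      (\<Sum>a\<in>V. \<Sum>c\<in>V. real (card (split_cherries k a c)) ^ 2) * real (card (V \<times> V))"
    unfolding sum.cartesian_product case_prod_unfold by (rule sum_squared_le_sum_of_squares)
  also have "\<dots> \<le> 2 * square_degree_sum * real (card (V \<times> V))"
    using sum_split_cherries_sq_le by (intro mult_right_mono) auto
  also have "\<dots> = (real (card V) * sqrt (2 * square_degree_sum))\<^sup>2"
    by (simp add: power_mult_distrib card_cartesian_product power2_eq_square)
  finally show ?thesis
    by (rule power2_le_imp_le) simp
qed

text \<open>With \<open>s\<close> the degree sum and \<open>Z\<close> the sum of squared degrees, an
  upper bound for \<open>Z\<close> in terms of \<open>s\<close> and \<open>sqrt Z\<close> is played
  against the Cauchy-Schwarz bound \<open>s\<^sup>2 \<le> Z * n\<close>.\<close>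

lemma sum_degree_le:
  assumes "\<And>a b. adj a b \<Longrightarrow> rk a b < 2 ^ H"
  shows "real (\<Sum>a\<in>V. card (nbh a)) \<le>
    2 * real (card V) + 6 * real H * (real (card V) * sqrt (real (card V)))"
proof -
  define n where "n = real (card V)"
  define s where "s = real (\<Sum>a\<in>V. card (nbh a))"
  define Z where "Z = real square_degree_sum"
  let ?r = "\<lambda>k a c. real (card (split_cherries k a c))"
  have nonneg: "n \<ge> 0" "s \<ge> 0" "Z \<ge> 0"
    by (auto simp: n_def s_def Z_def intro: sum_nonneg)
  have sZ: "s\<^sup>2 \<le> Z * n"
    using sum_squared_le_sum_of_squares[of "\<lambda>a. real (card (nbh a))" V]
    by (simp add: s_def Z_def n_def square_degree_sum_def)
  have "Z = (\<Sum>a\<in>V. \<Sum>c\<in>V. real (card (nbh a \<inter> nbh c)))"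
    by (simp add: Z_def flip: sum_card_common_nbh)
  also have "\<dots> \<le> (\<Sum>a\<in>V. \<Sum>c\<in>V.
      (if a = c then real (card (nbh a)) else 0) + (\<Sum>k<H. ?r k a c + ?r k c a))"
  proof (intro sum_mono)
    fix a c
    show "real (card (nbh a \<inter> nbh c)) \<le>
        (if a = c then real (card (nbh a)) else 0) + (\<Sum>k<H. ?r k a c + ?r k c a)"
    proof (cases "a = c")
      case False
      have "real (card (nbh a \<inter> nbh c)) \<le>
          real (\<Sum>k<H. card (split_cherries k a c) + card (split_cherries k c a))"
        using card_common_nbh_le[OF assms False] by (simp only: of_nat_le_iff)
      with False show ?thesis by simp
    qed (simp add: sum_nonneg)
  qed
  also have "\<dots> = s + (\<Sum>k<H. 2 * (\<Sum>a\<in>V. \<Sum>c\<in>V. ?r k a c))"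
  proof -
    have "(\<Sum>a\<in>V. \<Sum>c\<in>V. \<Sum>k<H. ?r k a c + ?r k c a) = (\<Sum>k<H. \<Sum>a\<in>V. \<Sum>c\<in>V. ?r k a c + ?r k c a)"
      by (simp only: sum.swap[of _ "{..<H}"])
    moreover have "(\<Sum>a\<in>V. \<Sum>c\<in>V. ?r k c a) = (\<Sum>a\<in>V. \<Sum>c\<in>V. ?r k a c)" for k
      by (rule sum.swap)
    ultimately show ?thesis
      using finite_V by (simp add: sum.distrib s_def)
  qed
  also have "\<dots> \<le> s + (\<Sum>k<H. 2 * (n * sqrt (2 * Z)))"
    using sum_split_cherries_le by (intro add_left_mono sum_mono mult_left_mono) (auto simp: n_def Z_def)
  finally have main: "Z \<le> s + 2 * H * n * sqrt (2 * Z)"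
    by simp
  show ?thesis
  \<comment> \<open>The cases tell which summand of \<open>main\<close> dominates: either
    \<open>s\<close> is linear in \<open>n\<close>, or one factor \<open>sqrt Z\<close>
    cancels.\<close>
  proof (cases "Z \<le> 2 * s")
    case True
    then have "s * s \<le> s * (2 * n)"
      using sZ mult_right_mono[OF True, of n] nonneg by (simp add: power2_eq_square algebra_simps)
    then have "s \<le> 2 * n"
      using nonneg by (cases "s = 0") auto
    moreover have "0 \<le> 6 * real H * (n * sqrt n)"
      using nonneg by simp
    ultimately show ?thesis
      unfolding s_def[symmetric] n_def[symmetric] by linarith
  next
    case False
    then have Z: "Z > 0"
      using nonneg by simp
    have "2 * (2 * H * n * sqrt (2 * Z)) = 4 * sqrt 2 * H * n * sqrt Z"
      by (simp add: real_sqrt_mult)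
    moreover from main False have "Z \<le> 2 * (2 * H * n * sqrt (2 * Z))"
      by linarith
    ultimately have "sqrt Z * sqrt Z \<le> (4 * sqrt 2 * H * n) * sqrt Z"
      using nonneg by (simp only: real_sqrt_mult_self abs_of_nonneg)
    then have "sqrt Z \<le> 4 * sqrt 2 * H * n"
      using Z by (simp only: mult_le_cancel_right) auto
    also have "\<dots> \<le> 6 * H * n"
    proof -
      have "sqrt 2 \<le> 3 / 2"
        by (rule real_le_lsqrt) (auto simp: power2_eq_square)
      then have "sqrt 2 * (H * n) \<le> 3 / 2 * (H * n)"
        using nonneg by (intro mult_right_mono) auto
      then show ?thesis by (simp add: algebra_simps)
    qed
    finally have "sqrt Z * sqrt n \<le> 6 * H * n * sqrt n"
      using nonneg by (intro mult_right_mono) auto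
    moreover have "s \<le> sqrt Z * sqrt n"
      using sZ nonneg by (simp add: real_le_rsqrt flip: real_sqrt_mult)
    ultimately show ?thesis
      unfolding s_def[symmetric] n_def[symmetric] using nonneg by (simp add: mult.assoc)
  qed
qed

end

section \<open>From edge orders to ranks and forbidden copies\<close>

lemma eo_contains_C4_1243I:
  assumes G: "edge_ordered_graph G"
    and dist: "distinct [a, b, c, d]"
    and edges: "{a, b} \<in> edges G" "{b, c} \<in> edges G" "{c, d} \<in> edges G" "{d, a} \<in> edges G"
    and ord: "({a, b}, {b, c}) \<in> eord G" "({b, c}, {d, a}) \<in> eord G" "({d, a}, {c, d}) \<in> eord G"
  shows "eo_contains G C4_1243"
proof -
  define E where "E = {{a, b}, {b, c}, {c, d}, {d, a}}"
  define S where "S = \<lparr>verts = {a, b, c, d}, edges = E, eord = eord G \<inter> (E \<times> E)\<rparr>"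
  \<comment> \<open>The default value 3 is the image of \<open>d\<close>.\<close>
  define f :: "'a \<Rightarrow> nat" where "f = (\<lambda>_. 3)(a := 0, b := 1, c := 2)"
  have lin: "refl_on (edges G) (eord G)" "trans (eord G)" "antisym (eord G)"
      "total_on (edges G) (eord G)"
    using G
    by (auto simp: edge_ordered_graph_def linear_order_on_def partial_order_on_def preorder_on_def)
  have E: "E \<subseteq> edges G"
    using edges by (simp add: E_def)
  have E4: "e \<subseteq> {a, b, c, d} \<and> card e = 2" if "e \<in> E" for e
    using that dist by (auto simp: E_def)
  have refl: "(e, e) \<in> eord G" if "e \<in> E" for e
    using that E lin(1) by (auto simp: refl_on_def)
  have "linear_order_on E (eord G \<inter> (E \<times> E))"
    unfolding linear_order_on_def partial_order_on_def preorder_on_def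
  proof (intro conjI)
    show "trans (eord G \<inter> (E \<times> E))"
      using lin(2) by (auto simp: trans_def)
    show "antisym (eord G \<inter> (E \<times> E))"
      using lin(3) by (auto simp: antisym_def)
    show "total_on E (eord G \<inter> (E \<times> E))"
      using lin(4) E by (auto simp: total_on_def)
  qed (auto simp: refl_on_def refl)
  then have "edge_ordered_graph S"
    using E4 by (simp add: edge_ordered_graph_def S_def subset_iff)
  moreover have "verts S \<subseteq> verts G"
    using G edges by (auto simp: S_def edge_ordered_graph_def)
  ultimately have sub: "eo_subgraph S G"
    using G E by (simp add: eo_subgraph_def S_def)

  \<comment> \<open>Transitivity supplies the remaining comparisons and antisymmetry excludes all
    reversed ones, so each of the sixteen pairs of edges is decided.\<close>
  have ord': "({a, b}, {d, a}) \<in> eord G" "({a, b}, {c, d}) \<in> eord G" "({b, c}, {c, d}) \<in> eord G"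
    using ord lin(2) by (meson transD)+
  have neq: "{a, b} \<noteq> {b, c}" "{a, b} \<noteq> {d, a}" "{a, b} \<noteq> {c, d}" "{b, c} \<noteq> {d, a}"
      "{b, c} \<noteq> {c, d}" "{d, a} \<noteq> {c, d}"
    using dist by (auto simp: doubleton_eq_iff)
  have nord: "({b, c}, {a, b}) \<notin> eord G" "({d, a}, {a, b}) \<notin> eord G" "({c, d}, {a, b}) \<notin> eord G"
      "({d, a}, {b, c}) \<notin> eord G" "({c, d}, {b, c}) \<notin> eord G" "({c, d}, {d, a}) \<notin> eord G"
    using ord ord' neq lin(3) by (meson antisymD)+
  have im: "f ` {a, b} = {0, 1}" "f ` {b, c} = {1, 2}" "f ` {c, d} = {2, 3}" "f ` {d, a} = {3, 0}"
    using dist by (auto simp: f_def)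
  have "bij_betw f {a, b, c, d} {0, 1, 2, 3}"
    using dist by (auto simp: bij_betw_def inj_on_def f_def)
  moreover have "\<forall>u\<in>{a, b, c, d}. \<forall>v\<in>{a, b, c, d}. {u, v} \<in> E \<longleftrightarrow>
      {f u, f v} \<in> {{0, 1}, {1, 2}, {2, 3}, {3, 0}}"
    using dist by (auto simp: E_def f_def doubleton_eq_iff)
  moreover have "(e, e') \<in> eord G \<longleftrightarrow> (f ` e, f ` e') \<in> eord C4_1243" if "e \<in> E" "e' \<in> E" for e e'
  proof -
    have refl': "({a, b}, {a, b}) \<in> eord G" "({b, c}, {b, c}) \<in> eord G"
        "({c, d}, {c, d}) \<in> eord G" "({d, a}, {d, a}) \<in> eord G"
      by (auto intro!: refl simp: E_def)
    show ?thesis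
      using that unfolding E_def
      by (elim insertE emptyE; hypsubst; unfold im;
          simp add: ord ord' nord refl' C4_1243_def labelled_graph_def doubleton_eq_iff)
  qed
  then have "\<forall>e\<in>E. \<forall>e'\<in>E. (e, e') \<in> eord G \<inter> (E \<times> E) \<longleftrightarrow> (f ` e, f ` e') \<in> eord C4_1243"
    by blast
  ultimately have "eo_isomorphic S C4_1243"
    unfolding eo_isomorphic_def
    by (intro exI[of _ f]) (simp add: S_def C4_1243_def labelled_graph_def)
  with sub show ?thesis
    by (auto simp: eo_contains_def)
qed

text \<open>The position of \<open>e\<close> in the edge order, counted from 0, so that blocks of
  consecutive edges become dyadic intervals of naturals.\<close>

definition edge_rank :: "'a eo_graph \<Rightarrow> 'a set \<Rightarrow> nat" where
  "edge_rank G e = card {e' \<in> edges G. (e', e) \<in> eord G \<and> e' \<noteq> e}"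

lemma finite_edges:
  assumes "edge_ordered_graph G"
  shows "finite (edges G)"
  using assms by (auto simp: edge_ordered_graph_def intro: finite_subset[of _ "Pow (verts G)"])

text \<open>The predecessors of \<open>e\<close> are also predecessors of \<open>e'\<close>, and
  \<open>e\<close> itself is one more.\<close>

lemma edge_rank_mono:
  assumes "edge_ordered_graph G" "(e, e') \<in> eord G" "e \<in> edges G" "e \<noteq> e'"
  shows "edge_rank G e < edge_rank G e'"
proof -
  have lin: "trans (eord G)" "antisym (eord G)"
    using assms(1)
    by (auto simp: edge_ordered_graph_def linear_order_on_def partial_order_on_def preorder_on_def)
  have "{f \<in> edges G. (f, e) \<in> eord G \<and> f \<noteq> e} \<subset> {f \<in> edges G. (f, e') \<in> eord G \<and> f \<noteq> e'}"
    using assms lin by (auto dest: transD antisymD)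
  then show ?thesis
    unfolding edge_rank_def using finite_edges[OF assms(1)] by (intro psubset_card_mono) auto
qed

lemma edge_rank_less_card:
  assumes "edge_ordered_graph G" "e \<in> edges G"
  shows "edge_rank G e < card (edges G)"
  unfolding edge_rank_def using assms finite_edges[OF assms(1)] by (intro psubset_card_mono) auto

lemma edge_rank_less_imp:
  assumes "edge_ordered_graph G" "e \<in> edges G" "e' \<in> edges G" "edge_rank G e < edge_rank G e'"
  shows "(e, e') \<in> eord G"
proof -
  have "total_on (edges G) (eord G)"
    using assms(1) by (simp add: edge_ordered_graph_def linear_order_on_def)
  moreover have "e \<noteq> e'"
    using assms(4) by auto
  ultimately have "(e, e') \<in> eord G \<or> (e', e) \<in> eord G"
    using assms by (auto simp: total_on_def)
  then show ?thesis
    using edge_rank_mono[of G e' e] assms by auto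
qed

lemma edge_rank_inj:
  assumes "edge_ordered_graph G" "e \<in> edges G" "e' \<in> edges G" "edge_rank G e = edge_rank G e'"
  shows "e = e'"
proof (rule ccontr)
  assume "e \<noteq> e'"
  moreover have "total_on (edges G) (eord G)"
    using assms(1) by (simp add: edge_ordered_graph_def linear_order_on_def)
  ultimately have "(e, e') \<in> eord G \<or> (e', e) \<in> eord G"
    using assms by (auto simp: total_on_def)
  then show False
    using edge_rank_mono[of G e' e] edge_rank_mono[of G e e'] assms \<open>e \<noteq> e'\<close> by auto
qed

section \<open>The explicit bound and its asymptotic form\<close>

lemma card_edges_le:
  assumes G: "edge_ordered_graph G" and free: "\<not> eo_contains G C4_1243"
    and n: "card (verts G) = n" "n \<ge> 2"
  shows "real (card (edges G)) \<le> 52 * (real n powr (3/2) * ln (real n))"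
proof -
  have edge: "x \<in> verts G" "y \<in> verts G" "x \<noteq> y" if "{x, y} \<in> edges G" for x y
    using G that by (auto simp: edge_ordered_graph_def)
  interpret ranked_graph "verts G" "\<lambda>a b. {a, b} \<in> edges G" "\<lambda>a b. edge_rank G {a, b}"
  proof
    show "finite (verts G)"
      using G by (simp add: edge_ordered_graph_def)
    fix a b c d
    show "a \<in> verts G" if "{a, b} \<in> edges G"
      using edge that by blast
    show "{b, a} \<in> edges G" if "{a, b} \<in> edges G"
      using that by (simp add: insert_commute)
    show "{a, a} \<notin> edges G"
      using edge by blast
    show "edge_rank G {a, b} = edge_rank G {b, a}"
      by (simp add: insert_commute)
    show "{a, b} = {c, d}" if "{a, b} \<in> edges G" "{c, d} \<in> edges G"
        "edge_rank G {a, b} = edge_rank G {c, d}"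
      using edge_rank_inj[OF G] that by blast
    show "\<not> (edge_rank G {a, b} < edge_rank G {b, c} \<and> edge_rank G {b, c} < edge_rank G {d, a} \<and>
        edge_rank G {d, a} < edge_rank G {c, d})"
      if "distinct [a, b, c, d]" "{a, b} \<in> edges G" "{b, c} \<in> edges G" "{c, d} \<in> edges G"
        "{d, a} \<in> edges G"
      using eo_contains_C4_1243I[OF G that] free edge_rank_less_imp[OF G] that by blast
  qed
  \<comment> \<open>Each edge comes from an ordered adjacent pair, so the degree sum bounds the
    number of edges, up to a harmless factor 2.\<close>
  have "edges G \<subseteq> (\<lambda>(a, b). {a, b}) ` (SIGMA a:verts G. nbh a)"
  proof
    fix e assume e: "e \<in> edges G"
    then have "card e = 2"
      using G by (auto simp: edge_ordered_graph_def)
    then obtain x y where "e = {x, y}"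
      by (auto simp: card_2_iff)
    with e edge show "e \<in> (\<lambda>(a, b). {a, b}) ` (SIGMA a:verts G. nbh a)"
      by (auto simp: nbh_def intro!: image_eqI[of _ _ "(x, y)"])
  qed
  then have "card (edges G) \<le> card (SIGMA a:verts G. nbh a)"
    using finite_V by (intro surj_card_le) auto
  also have "\<dots> = (\<Sum>a\<in>verts G. card (nbh a))"
    using finite_V by simp
  finally have m: "card (edges G) \<le> (\<Sum>a\<in>verts G. card (nbh a))" .
  also have "\<dots> \<le> (\<Sum>a\<in>verts G. n)"
    using n finite_V nbh_subset by (intro sum_mono) (auto intro: card_mono)
  finally have mn: "card (edges G) \<le> n * n"
    using n by simp

  \<comment> \<open>There are at most \<open>n * n\<close> edges and \<open>n \<le> 2 ^ L\<close>,
    so \<open>2 * L\<close> levels suffice.\<close>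
  define L where "L = nat \<lceil>log 2 n\<rceil>"
  have log: "log 2 n \<ge> 1"
    using n by simp
  have "real n = 2 powr (log 2 n)"
    using n by simp
  also have "\<dots> \<le> 2 powr L"
    unfolding L_def by (intro powr_mono) linarith+
  finally have "n \<le> 2 ^ L"
    by (simp add: powr_realpow)
  then have "n * n \<le> 2 ^ (2 * L)"
    by (simp add: mult_2 power_add mult_mono)
  then have rank: "edge_rank G {a, b} < 2 ^ (2 * L)" if "{a, b} \<in> edges G" for a b
    using edge_rank_less_card[OF G that] mn by linarith
  have "ln 2 \<ge> (1/2 :: real)"
    using ln_le_minus_one[of "1/2"] by (simp add: ln_div)
  then have "log 2 n * (1/2) \<le> log 2 n * ln 2"
    using log by (intro mult_left_mono) auto
  also have "\<dots> = ln n"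
    by (simp add: log_def)
  finally have ln: "log 2 n \<le> 2 * ln n"
    by simp
  have "real L \<le> log 2 n + 1"
    unfolding L_def using log by linarith
  \<comment> \<open>Since \<open>log 2 n \<ge> 1\<close>, the rounding error is absorbed:
    \<open>2 * L \<le> 4 * log 2 n \<le> 8 * ln n\<close>.\<close>
  then have "2 * real L \<le> 8 * ln n"
    using ln log by linarith
  then have H: "real (2 * L) \<le> 8 * ln n"
    by simp
  have npow: "real n * sqrt n = n powr (3/2)"
    using n powr_add[of "real n" 1 "1/2"] by (simp add: powr_half_sqrt)
  have "real (card (edges G)) \<le> real (\<Sum>a\<in>verts G. card (nbh a))"
    using m by (simp only: of_nat_le_iff)
  also have "\<dots> \<le> 2 * real n + 6 * real (2 * L) * (real n * sqrt n)"
    using sum_degree_le[OF rank] n by simp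
  \<comment> \<open>The linear term is absorbed using \<open>1 \<le> log 2 n \<le> 2 * ln n\<close>;
    the constants add up to \<open>2 * 2 + 6 * 8 = 52\<close>.\<close>
  also have "\<dots> \<le> 2 * (real n powr (3/2) * (2 * ln n)) + 6 * (8 * ln n) * real n powr (3/2)"
  proof (intro add_mono)
    have "real n * 1 \<le> real n * sqrt n"
      using n by (intro mult_left_mono) auto
    also have "\<dots> * 1 \<le> real n powr (3/2) * (2 * ln n)"
      unfolding npow using ln log by (intro mult_left_mono) auto
    finally show "2 * real n \<le> 2 * (real n powr (3/2) * (2 * ln n))"
      by linarith
    show "6 * real (2 * L) * (real n * sqrt n) \<le> 6 * (8 * ln n) * real n powr (3/2)"
      unfolding npow using H by (intro mult_right_mono) auto
  qed
  also have "\<dots> = 52 * (real n powr (3/2) * ln n)"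
    by simp
  finally show ?thesis .
qed

theorem theorem5p1:
  shows "(\<lambda>n::nat. real (ex_less n C4_1243)) \<in> O(\<lambda>n. real n powr (3/2) * ln (real n))"
proof (rule bigoI)
  show "\<forall>\<^sub>F n in sequentially. norm (real (ex_less n C4_1243)) \<le>
      52 * norm (real n powr (3/2) * ln (real n))"
  proof (rule eventually_sequentiallyI)
    fix n :: nat assume n: "n \<ge> 2"
    have "edges C4_1243 \<noteq> {}"
      by (simp add: C4_1243_def labelled_graph_def)
    \<comment> \<open>The maximum is attained, so it is the edge count of an actual graph avoiding
      the cycle.\<close>
    then have "ex_less n C4_1243 \<in> ex_sizes n C4_1243"
      unfolding ex_less_def
      by (intro Max_in ex_sizes_finite ex_sizes_nonempty C4_1243_edge_ordered)
    then have "real (ex_less n C4_1243) \<le> 52 * (real n powr (3/2) * ln (real n))"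
      using n by (auto simp: ex_sizes_def intro!: card_edges_le)
    moreover have "ln (real n) \<ge> 0"
      using n by simp
    ultimately show "norm (real (ex_less n C4_1243)) \<le>
        52 * norm (real n powr (3/2) * ln (real n))"
      by (simp add: abs_mult)
  qed
qed

end
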